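(* For every function $\varphi\in L^1(I_0)$, every number $\lambda>0$ and every family $\{\varepsilon_I\}$ with $|\varepsilon_I|=1$, $$\Big|\Big\{x\in I_0:\ \Big|\sum_{I\subset I_0,\ I\in D}\varepsilon_I(\varphi,h_I)h_I(x)\Big|\ge\lambda\Big\}\Big|\le 4\,\frac{\|\varphi\|_1}{\lambda}.$$
   Context: $I_0=[0,1]$; $D$ is the collection of dyadic intervals; $|\cdot|$ applied to sets is Lebesgue measure. For a dyadic interval $I$ with left half $I_-$ and right half $I_+$, the Haar function is $h_I=|I|^{-1/2}$ on $I_+$, $h_I=-|I|^{-1/2}$ on $I_-$, and $0$ off $I$. $(\varphi,h_I)=\int\varphi h_I$, $\|\varphi\|_1=\int_{I_0}|\varphi|$. Functions $\varphi$ are real-valued and $\varepsilon_I\in\{-1,1\}$. The Haar sum is understood as the almost everywhere limit, as $n\to\infty$, of the partial sums over dyadic $I\subset I_0$ with $|I|\ge 2^{-n}$ (this limit exists a.e. for $\varphi\in L^1(I_0)$). *)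

theory Defs
  imports "HOL-Analysis.Analysis"
begin

definition unit_interval :: "real set" where
  "unit_interval = {0..1}"

text \<open>
  Dyadic intervals are taken half-open, so that every interval is the disjoint union of its two
  halves; any other choice of end points changes the Haar functions only on a countable set.
\<close>
definition dyadic_intervals :: "real set set" where
  "dyadic_intervals =
     {{of_int k * 2 powi j ..< (of_int k + 1) * 2 powi j} | (j::int) (k::int). True}"

definition left_half :: "real set \<Rightarrow> real set" where
  "left_half I = {x \<in> I. x < (Inf I + Sup I) / 2}"

definition right_half :: "real set \<Rightarrow> real set" where
  "right_half I = {x \<in> I. (Inf I + Sup I) / 2 \<le> x}"

definition haar :: "real set \<Rightarrow> real \<Rightarrow> real" where
  "haar I x = (if x \<in> right_half I then 1 / sqrt (measure lebesgue I)
               else if x \<in> left_half I then - (1 / sqrt (measure lebesgue I))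
               else 0)"

definition haar_coeff :: "(real \<Rightarrow> real) \<Rightarrow> real set \<Rightarrow> real" where
  "haar_coeff \<phi> I = (LINT x:unit_interval|lebesgue. \<phi> x * haar I x)"

definition L1_norm :: "(real \<Rightarrow> real) \<Rightarrow> real" where
  "L1_norm \<phi> = (LINT x:unit_interval|lebesgue. \<bar>\<phi> x\<bar>)"

definition unit_dyadic_upto :: "nat \<Rightarrow> real set set" where
  "unit_dyadic_upto n =
     {I \<in> dyadic_intervals. I \<subseteq> unit_interval \<and> measure lebesgue I \<ge> (1/2) ^ n}"

definition haar_partial_sum ::
    "(real set \<Rightarrow> real) \<Rightarrow> (real \<Rightarrow> real) \<Rightarrow> nat \<Rightarrow> real \<Rightarrow> real" where
  "haar_partial_sum \<epsilon> \<phi> n x = (\<Sum>I\<in>unit_dyadic_upto n. \<epsilon> I * haar_coeff \<phi> I * haar I x)"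

text \<open>
  At points where the partial sums diverge (a null set if \<open>\<phi>\<close> is integrable on the unit interval
  and \<open>\<epsilon>\<close> takes the values 1 and -1), \<^const>\<open>lim\<close> returns an unspecified value.
\<close>
definition haar_sum :: "(real set \<Rightarrow> real) \<Rightarrow> (real \<Rightarrow> real) \<Rightarrow> real \<Rightarrow> real" where
  "haar_sum \<epsilon> \<phi> x = lim (\<lambda>n. haar_partial_sum \<epsilon> \<phi> n x)"

text \<open>
  The following facts exclude degenerate readings of \<^const>\<open>sum\<close> (zero on infinite index sets)
  and of \<^const>\<open>measure\<close> (zero on non-measurable sets).
\<close>

lemma finite_unit_dyadic_upto: "finite (unit_dyadic_upto n)"
proof -
  let ?I = "\<lambda>(j::int, k::int). {of_int k * 2 powi j ..< (of_int k + 1) * 2 powi j :: real}"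
  have "unit_dyadic_upto n \<subseteq> ?I ` ({- int n..0} \<times> {0..2 ^ n})"
  proof
    fix I assume "I \<in> unit_dyadic_upto n"
    then obtain j k where I: "I = ?I (j, k)" and sub: "I \<subseteq> {0..1}"
      and big: "measure lebesgue I \<ge> (1/2) ^ n"
      by (auto simp: unit_dyadic_upto_def dyadic_intervals_def unit_interval_def)
    define a :: real where "a = 2 powi j"
    have a0: "a > 0" by (simp add: a_def)
    have I': "I = {of_int k * a ..< of_int k * a + a}"
      using I by (simp add: a_def algebra_simps)
    have am: "a \<ge> (1/2) ^ n" using big a0 by (simp add: I')
    have "0 \<le> of_int k * a \<and> of_int k * a + a \<le> 1"
      using sub a0 unfolding I' atLeastLessThan_subseteq_atLeastAtMost_iff by simp
    then have lo: "0 \<le> of_int k * a" and hi: "of_int k * a + a \<le> 1" by auto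
    have k0: "k \<ge> 0" using lo a0 by (simp add: zero_le_mult_iff)
    have "(1/2::real) ^ n = 2 powi (- int n)"
      by (simp add: power_int_minus power_one_over inverse_eq_divide)
    then have "(2::real) powi (- int n) \<le> 2 powi j" using am by (simp add: a_def)
    then have j1: "- int n \<le> j"
      using power_int_strict_increasing[of j "- int n" "2::real"] by force
    have "(2::real) powi j \<le> 2 powi 0" using hi lo by (simp add: a_def)
    then have j2: "j \<le> 0"
      using power_int_strict_increasing[of 0 j "2::real"] by force
    have "of_int k * (1/2) ^ n \<le> of_int k * a" using am k0 by (intro mult_left_mono) auto
    also have "\<dots> \<le> 1" using hi a0 by simp
    finally have "of_int k \<le> (2::real) ^ n" by (simp add: power_one_over field_simps)
    then have "k \<le> 2 ^ n" by (metis of_int_le_iff of_int_numeral of_int_power)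
    with k0 j1 j2 I show "I \<in> ?I ` ({- int n..0} \<times> {0..2 ^ n})" by force
  qed
  then show ?thesis by (rule finite_subset) auto
qed

lemma measurable_haar: "I \<in> dyadic_intervals \<Longrightarrow> haar I \<in> borel_measurable borel"
proof -
  assume "I \<in> dyadic_intervals"
  then have [measurable]: "I \<in> sets borel" by (auto simp: dyadic_intervals_def)
  show ?thesis
    unfolding haar_def left_half_def right_half_def by measurable
qed

lemma measurable_haar_sum: "haar_sum \<epsilon> \<phi> \<in> borel_measurable borel"
proof -
  have [measurable]: "haar_partial_sum \<epsilon> \<phi> n \<in> borel_measurable borel" for n
    unfolding haar_partial_sum_def
    by (intro borel_measurable_sum borel_measurable_times borel_measurable_const measurable_haar)
       (auto simp: unit_dyadic_upto_def)
  show ?thesis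
    unfolding haar_sum_def by measurable
qed

end

theory Submission
  imports Defs
begin

text \<open>
  Up to normalisation the Haar sum is a martingale transform \<open>y\<close> of the dyadic martingale \<open>x\<close> of \<open>\<phi>\<close>,
  with increments equal to those of \<open>x\<close> up to sign. Burkholder's function \<open>U(x, y)\<close>, equal to
  \<open>y\<^sup>2 - x\<^sup>2\<close> for \<open>\<bar>x\<bar> + \<bar>y\<bar> \<le> 1\<close> and to \<open>1 - 2\<bar>x\<bar>\<close> otherwise, is concave along lines of slope
  \<open>\<plusminus>1\<close>, dominates \<open>1 - 2\<bar>x\<bar>\<close> for \<open>\<bar>y\<bar> \<ge> 1\<close> and \<open>-2\<bar>x\<bar>\<close> everywhere, and is nonpositive at \<open>y = 0\<close>.
  Induction over dyadic levels therefore gives the weak-type bound with constant 2 for the maximal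
  partial sum. Applied to the difference of \<open>\<phi>\<close> and a dyadic step function, whose Haar expansion
  is finite, it yields almost everywhere convergence; applied to \<open>\<phi>\<close> at height \<open>lam / 2\<close>, which
  some partial sum must reach where the limit reaches \<open>lam\<close>, it yields the constant 4.
\<close>

section \<open>Dyadic intervals indexed by level and position\<close>

definition dyadic :: "nat \<Rightarrow> nat \<Rightarrow> real set" where
  "dyadic m k = {real k / 2 ^ m ..< (real k + 1) / 2 ^ m}"

lemma dyadic_borel [measurable]: "dyadic m k \<in> sets borel"
  by (simp add: dyadic_def)

lemma dyadic_lebesgue [measurable]: "dyadic m k \<in> sets lebesgue"
  by (simp add: dyadic_def)

lemma measure_dyadic: "measure lebesgue (dyadic m k) = (1/2) ^ m"
proof -
  have "real k / 2 ^ m \<le> (real k + 1) / 2 ^ m"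
    by (simp add: divide_right_mono)
  then show ?thesis
    by (simp add: dyadic_def power_one_over flip: diff_divide_distrib)
qed

lemma dyadic_lmeasurable: "dyadic m k \<in> lmeasurable"
  by (simp add: dyadic_def bounded_set_imp_lmeasurable)

lemma dyadic_subset_unit:
  assumes "k < 2 ^ m"
  shows "dyadic m k \<subseteq> unit_interval"
proof -
  have "real k + 1 \<le> 2 ^ m"
    using assms by (metis Suc_leI add.commute of_nat_Suc of_nat_le_iff of_nat_numeral of_nat_power)
  then have "(real k + 1) / 2 ^ m \<le> 1"
    by simp
  moreover have "0 \<le> real k / 2 ^ m" by simp
  ultimately show ?thesis
    unfolding dyadic_def unit_interval_def by (meson atLeastLessThan_subseteq_atLeastAtMost_iff)
qed

text \<open>The floor form makes disjointness within a level immediate and later ties these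
  intervals to step functions of \<open>\<lfloor>x * 2 ^ N\<rfloor>\<close>.\<close>

lemma dyadic_mem_iff: "x \<in> dyadic m k \<longleftrightarrow> \<lfloor>x * 2 ^ m\<rfloor> = int k"
  by (simp add: dyadic_def floor_eq_iff field_simps)

lemma dyadic_inj: "x \<in> dyadic m k \<Longrightarrow> x \<in> dyadic m k' \<Longrightarrow> k = k'"
  by (simp add: dyadic_mem_iff)

lemma dyadic_Inf_Sup: "Inf (dyadic m k) = real k / 2 ^ m" "Sup (dyadic m k) = (real k + 1) / 2 ^ m"
  by (simp_all add: dyadic_def divide_strict_right_mono)

lemma right_half_dyadic: "right_half (dyadic m k) = dyadic (Suc m) (2 * k + 1)"
  and left_half_dyadic: "left_half (dyadic m k) = dyadic (Suc m) (2 * k)"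
  by (auto simp: right_half_def left_half_def dyadic_Inf_Sup dyadic_def field_simps)

lemma dyadic_split:
  "dyadic m k = dyadic (Suc m) (2 * k) \<union> dyadic (Suc m) (2 * k + 1)"
  "dyadic (Suc m) (2 * k) \<inter> dyadic (Suc m) (2 * k + 1) = {}"
  by (auto simp: dyadic_def field_simps)

lemma dyadic_in_dyadic_intervals: "dyadic m k \<in> dyadic_intervals"
proof -
  have "dyadic m k = {of_int (int k) * 2 powi (- int m) ..< (of_int (int k) + 1) * 2 powi (- int m)}"
    by (simp add: dyadic_def power_int_minus field_simps)
  then show ?thesis unfolding dyadic_intervals_def by blast
qed

text \<open>The length determines the level, and the left end point then determines the index. This
  injectivity allows sums over intervals to be rewritten as sums over pairs.\<close>

lemma dyadic_eq_iff: "dyadic m k = dyadic n l \<longleftrightarrow> m = n \<and> k = l"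
proof
  assume *: "dyadic m k = dyadic n l"
  then have "(1/2::real) ^ m = (1/2) ^ n" using measure_dyadic[of m k] measure_dyadic[of n l] by simp
  then have "(2::real) ^ m = 2 ^ n" by (simp add: power_one_over)
  then have "m = n" using power_inject_exp[of "2::real" m n] by simp
  moreover have "real k / 2 ^ m = real l / 2 ^ n"
    using arg_cong[OF *, of Inf] by (simp only: dyadic_Inf_Sup)
  ultimately show "m = n \<and> k = l" by simp
qed simp

text \<open>Containment in \<open>unit_interval\<close> forces length at most 1 and a nonnegative
  left end point; the lower bound on the measure forces length at least \<open>(1/2) ^ n\<close>. So
  the integer exponent lies between \<open>- n\<close> and 0, and natural numbers suffice as
  indices.\<close>

lemma unit_dyadic_upto_eq:
  "unit_dyadic_upto n = (\<lambda>(m, k). dyadic m k) ` (SIGMA m:{..n}. {..<2 ^ m})"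
proof (intro equalityI subsetI)
  fix I assume "I \<in> unit_dyadic_upto n"
  then obtain j k where I: "I = {of_int k * 2 powi j ..< (of_int k + 1) * 2 powi j :: real}"
    and sub: "I \<subseteq> {0..1}" and big: "measure lebesgue I \<ge> (1/2) ^ n"
    by (auto simp: unit_dyadic_upto_def dyadic_intervals_def unit_interval_def)
  define a :: real where "a = 2 powi j"
  have a0: "a > 0" by (simp add: a_def)
  have I': "I = {of_int k * a ..< of_int k * a + a}"
    using I by (simp add: a_def algebra_simps)
  have am: "a \<ge> (1/2) ^ n" using big a0 by (simp add: I')
  have "0 \<le> of_int k * a \<and> of_int k * a + a \<le> 1"
    using sub a0 unfolding I' atLeastLessThan_subseteq_atLeastAtMost_iff by simp
  then have lo: "0 \<le> of_int k * a" and hi: "of_int k * a + a \<le> 1" by auto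
  have k0: "k \<ge> 0" using lo a0 by (simp add: zero_le_mult_iff)
  have "(1/2::real) ^ n = 2 powi (- int n)"
    by (simp add: power_int_minus power_one_over inverse_eq_divide)
  then have "(2::real) powi (- int n) \<le> 2 powi j" using am by (simp add: a_def)
  then have j1: "- int n \<le> j"
    using power_int_strict_increasing[of j "- int n" "2::real"] by force
  have "(2::real) powi j \<le> 2 powi 0" using hi lo by (simp add: a_def)
  then have j2: "j \<le> 0"
    using power_int_strict_increasing[of 0 j "2::real"] by force
  \<comment> \<open>The level is the negated exponent: length \<open>2 powi j\<close> is
    \<open>1 / 2 ^ m\<close>.\<close>
  define m where "m = nat (- j)"
  have m: "m \<le> n" and jm: "j = - int m" using j1 j2 by (auto simp: m_def)
  have a: "a = 1 / 2 ^ m" by (simp add: a_def jm power_int_minus inverse_eq_divide)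
  have "I = dyadic m (nat k)"
    using k0 unfolding I' a dyadic_def by (simp add: add_divide_distrib)
  moreover have "nat k < 2 ^ m"
  proof -
    have "real_of_int (k + 1) \<le> real_of_int (2 ^ m)" using hi by (simp add: a field_simps)
    then have "k + 1 \<le> 2 ^ m" unfolding of_int_le_iff .
    then show ?thesis using k0 by (simp add: nat_less_iff)
  qed
  ultimately show "I \<in> (\<lambda>(m, k). dyadic m k) ` (SIGMA m:{..n}. {..<2 ^ m})"
    using m by (intro image_eqI[of _ _ "(m, nat k)"]) auto
next
  fix I assume "I \<in> (\<lambda>(m, k). dyadic m k) ` (SIGMA m:{..n}. {..<2 ^ m})"
  then obtain m k where "I = dyadic m k" "m \<le> n" "k < 2 ^ m" by auto
  then show "I \<in> unit_dyadic_upto n"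
    using dyadic_in_dyadic_intervals[of m k] dyadic_subset_unit[of k m]
    by (simp add: unit_dyadic_upto_def measure_dyadic power_decreasing)
qed

section \<open>Haar layers as signed increments of the dyadic averages\<close>

definition haar_layer :: "(real set \<Rightarrow> real) \<Rightarrow> (real \<Rightarrow> real) \<Rightarrow> nat \<Rightarrow> real \<Rightarrow> real" where
  "haar_layer \<epsilon> \<phi> m x =
     (\<Sum>k<2 ^ m. \<epsilon> (dyadic m k) * haar_coeff \<phi> (dyadic m k) * haar (dyadic m k) x)"

text \<open>Groups the sum by interval length. The partial sum with index \<open>n\<close> contains
  the levels 0 to \<open>n\<close> inclusive, hence \<open>Suc n\<close> layers.\<close>

lemma haar_partial_sum_eq: "haar_partial_sum \<epsilon> \<phi> n x = (\<Sum>m<Suc n. haar_layer \<epsilon> \<phi> m x)"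
proof -
  have "inj_on (\<lambda>(m, k). dyadic m k) (SIGMA m:{..n}. {..<2 ^ m})"
    by (auto simp: inj_on_def dyadic_eq_iff)
  then show ?thesis
    unfolding haar_partial_sum_def unit_dyadic_upto_eq haar_layer_def lessThan_Suc_atMost
    by (simp add: sum.reindex sum.Sigma split_def)
qed

lemma haar_layer_measurable [measurable]: "haar_layer \<epsilon> \<phi> m \<in> borel_measurable borel"
  unfolding haar_layer_def
  by (intro borel_measurable_sum borel_measurable_times borel_measurable_const measurable_haar
      dyadic_in_dyadic_intervals)

lemma haar_layer_measurable_lebesgue [measurable]: "haar_layer \<epsilon> \<phi> m \<in> borel_measurable lebesgue"
  by (simp add: measurable_completion haar_layer_measurable)

text \<open>The value on \<open>dyadic m k\<close> of the dyadic martingale of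
  \<open>\<phi>\<close>; the factor \<open>2 ^ m\<close> is the reciprocal of the length.\<close>

definition dyadic_avg :: "(real \<Rightarrow> real) \<Rightarrow> nat \<Rightarrow> nat \<Rightarrow> real" where
  "dyadic_avg \<phi> m k = 2 ^ m * (LINT x:dyadic m k|lebesgue. \<phi> x)"

lemma set_integrable_dyadic:
  fixes \<phi> :: "real \<Rightarrow> real"
  assumes "set_integrable lebesgue unit_interval \<phi>" "k < 2 ^ m"
  shows "set_integrable lebesgue (dyadic m k) \<phi>"
  by (rule set_integrable_subset[OF assms(1) dyadic_lebesgue dyadic_subset_unit[OF assms(2)]])

lemma set_integral_dyadic_split:
  fixes \<phi> :: "real \<Rightarrow> real"
  assumes "set_integrable lebesgue unit_interval \<phi>" "k < 2 ^ m"
  shows "(LINT x:dyadic m k|lebesgue. \<phi> x) =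
    (LINT x:dyadic (Suc m) (2*k)|lebesgue. \<phi> x) + (LINT x:dyadic (Suc m) (2*k+1)|lebesgue. \<phi> x)"
  using assms unfolding dyadic_split(1)[of m k]
  by (intro set_integral_Un dyadic_split(2) set_integrable_dyadic) auto

lemma dyadic_avg_split:
  assumes "set_integrable lebesgue unit_interval \<phi>" "k < 2 ^ m"
  shows "dyadic_avg \<phi> m k = (dyadic_avg \<phi> (Suc m) (2*k) + dyadic_avg \<phi> (Suc m) (2*k+1)) / 2"
  using set_integral_dyadic_split[OF assms] by (simp add: dyadic_avg_def algebra_simps)

text \<open>Written with indicators of the two halves, a Haar coefficient becomes a difference of
  two integrals; \<open>sqrt (2 ^ m)\<close> is the normalisation for length
  \<open>(1/2) ^ m\<close>.\<close>

lemma haar_dyadic: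
  "haar (dyadic m k) x = sqrt (2 ^ m) *
     (indicator (dyadic (Suc m) (2*k+1)) x - indicator (dyadic (Suc m) (2*k)) x)"
  using dyadic_split(2)[of m k]
  by (auto simp: haar_def right_half_dyadic left_half_dyadic measure_dyadic indicator_def
      power_one_over real_sqrt_divide)

lemma haar_coeff_dyadic:
  assumes "set_integrable lebesgue unit_interval \<phi>" "k < 2 ^ m"
  shows "haar_coeff \<phi> (dyadic m k) = sqrt (2 ^ m) *
    ((LINT x:dyadic (Suc m) (2*k+1)|lebesgue. \<phi> x) - (LINT x:dyadic (Suc m) (2*k)|lebesgue. \<phi> x))"
proof -
  have *: "set_integrable lebesgue (dyadic (Suc m) (2*k+1)) \<phi>"
    "set_integrable lebesgue (dyadic (Suc m) (2*k)) \<phi>"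
    using assms by (auto intro!: set_integrable_dyadic)
  \<comment> \<open>Both halves lie in \<open>unit_interval\<close>, so the cut-off in
    \<open>haar_coeff\<close> changes nothing.\<close>
  have "dyadic (Suc m) (2*k+1) \<subseteq> unit_interval" "dyadic (Suc m) (2*k) \<subseteq> unit_interval"
    using assms(2) by (auto intro!: dyadic_subset_unit simp del: power_Suc) auto
  then have "indicator unit_interval x *\<^sub>R (\<phi> x * haar (dyadic m k) x) = sqrt (2 ^ m) *
    (indicator (dyadic (Suc m) (2*k+1)) x *\<^sub>R \<phi> x - indicator (dyadic (Suc m) (2*k)) x *\<^sub>R \<phi> x)" for x
    by (auto simp: haar_dyadic indicator_def)
  then show ?thesis
    unfolding haar_coeff_def set_lebesgue_integral_def
    using * by (simp add: set_integrable_def)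
qed

text \<open>Intervals of one level are disjoint, so a single term of the layer survives at a given
  point.\<close>

lemma haar_layer_on_dyadic:
  assumes "x \<in> dyadic m k" "k < 2 ^ m"
  shows "haar_layer \<epsilon> \<phi> m x = \<epsilon> (dyadic m k) * haar_coeff \<phi> (dyadic m k) * haar (dyadic m k) x"
proof -
  have "haar (dyadic m l) x = 0" if "l \<noteq> k" for l
  proof -
    have "x \<notin> dyadic m l" using dyadic_inj[OF assms(1)] that by blast
    then have "x \<notin> dyadic (Suc m) (2*l)" "x \<notin> dyadic (Suc m) (2*l+1)"
      unfolding dyadic_split(1)[of m l] by blast+
    then show ?thesis by (simp add: haar_dyadic)
  qed
  then have "haar_layer \<epsilon> \<phi> m x =
      (\<Sum>l<2 ^ m. if l = k then \<epsilon> (dyadic m k) * haar_coeff \<phi> (dyadic m k) * haar (dyadic m k) x else 0)"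
    unfolding haar_layer_def by (intro sum.cong) auto
  then show ?thesis using assms(2) by simp
qed

text \<open>The coefficient and the Haar function each contribute \<open>sqrt (2 ^ m)\<close>; their
  product cancels the normalisation of the averages. Hence a layer is, up to the sign
  \<open>\<epsilon> (dyadic m k)\<close>, the increment of the dyadic martingale: plus half the
  difference of the two averages on the right half, minus it on the left.\<close>

lemma
  assumes "set_integrable lebesgue unit_interval \<phi>" "k < 2 ^ m"
  shows haar_layer_right: "x \<in> dyadic (Suc m) (2*k+1) \<Longrightarrow> haar_layer \<epsilon> \<phi> m x =
      \<epsilon> (dyadic m k) * ((dyadic_avg \<phi> (Suc m) (2*k+1) - dyadic_avg \<phi> (Suc m) (2*k)) / 2)"
    and haar_layer_left: "x \<in> dyadic (Suc m) (2*k) \<Longrightarrow> haar_layer \<epsilon> \<phi> m x =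
      - \<epsilon> (dyadic m k) * ((dyadic_avg \<phi> (Suc m) (2*k+1) - dyadic_avg \<phi> (Suc m) (2*k)) / 2)"
proof -
  have *: "haar_layer \<epsilon> \<phi> m x = \<epsilon> (dyadic m k) * (haar_coeff \<phi> (dyadic m k) * haar (dyadic m k) x)"
    if "x \<in> dyadic m k"
    using haar_layer_on_dyadic[OF that assms(2)] by (simp add: mult.assoc)
  define R L where "R = (LINT x:dyadic (Suc m) (2*k+1)|lebesgue. \<phi> x)"
    and "L = (LINT x:dyadic (Suc m) (2*k)|lebesgue. \<phi> x)"
  have d: "(dyadic_avg \<phi> (Suc m) (2*k+1) - dyadic_avg \<phi> (Suc m) (2*k)) / 2 = 2 ^ m * (R - L)"
    unfolding dyadic_avg_def R_def[symmetric] L_def[symmetric] by (simp add: field_simps)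
  have c: "haar_coeff \<phi> (dyadic m k) * (sqrt (2 ^ m) * s) = 2 ^ m * (R - L) * s" for s
  proof -
    have "sqrt (2 ^ m) * (R - L) * (sqrt (2 ^ m) * s) = (sqrt (2 ^ m) * sqrt (2 ^ m)) * (R - L) * s"
      by (simp only: mult_ac)
    then show ?thesis
      unfolding haar_coeff_dyadic[OF assms] R_def[symmetric] L_def[symmetric] by simp
  qed
  show "haar_layer \<epsilon> \<phi> m x =
      \<epsilon> (dyadic m k) * ((dyadic_avg \<phi> (Suc m) (2*k+1) - dyadic_avg \<phi> (Suc m) (2*k)) / 2)"
    if "x \<in> dyadic (Suc m) (2*k+1)"
  proof -
    have "x \<in> dyadic m k" "x \<notin> dyadic (Suc m) (2*k)" using that dyadic_split[of m k] by auto
    with that show ?thesis unfolding d using * c[of 1] by (simp add: haar_dyadic)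
  qed
  show "haar_layer \<epsilon> \<phi> m x =
      - \<epsilon> (dyadic m k) * ((dyadic_avg \<phi> (Suc m) (2*k+1) - dyadic_avg \<phi> (Suc m) (2*k)) / 2)"
    if "x \<in> dyadic (Suc m) (2*k)"
  proof -
    have "x \<in> dyadic m k" "x \<notin> dyadic (Suc m) (2*k+1)" using that dyadic_split[of m k] by auto
    with that show ?thesis unfolding d using * c[of "-1"] by (simp add: haar_dyadic)
  qed
qed

section \<open>Burkholder's function and its concavity along lines of slope 1 and -1\<close>

definition burkholder :: "real \<Rightarrow> real \<Rightarrow> real" where
  "burkholder x y = (if \<bar>x\<bar> + \<bar>y\<bar> \<le> 1 then y\<^sup>2 - x\<^sup>2 else 1 - 2 * \<bar>x\<bar>)"

text \<open>In the diamond \<open>\<bar>x\<bar> + \<bar>y\<bar> \<le> 1\<close> one has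
  \<open>\<bar>y\<bar> \<le> 1 - \<bar>x\<bar>\<close>, and squaring gives the bound; on the
  boundary it is an equality, so the two branches fit together there.\<close>

lemma burkholder_le: "burkholder x y \<le> 1 - 2 * \<bar>x\<bar>"
proof (cases "\<bar>x\<bar> + \<bar>y\<bar> \<le> 1")
  case True
  then have "\<bar>y\<bar>\<^sup>2 \<le> (1 - \<bar>x\<bar>)\<^sup>2" by (intro power_mono) auto
  with True show ?thesis by (simp add: burkholder_def power2_diff)
qed (simp add: burkholder_def)

text \<open>Keeps the right-hand side of the weak-type bound nonnegative when the set to be measured
  is empty.\<close>

lemma burkholder_ge: "- 2 * \<bar>x\<bar> \<le> burkholder x y"
proof (cases "\<bar>x\<bar> + \<bar>y\<bar> \<le> 1")
  case True
  then have "\<bar>x\<bar> * \<bar>x\<bar> \<le> \<bar>x\<bar> * 2" by (intro mult_left_mono) auto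
  then have "x\<^sup>2 \<le> 2 * \<bar>x\<bar>" by (simp add: power2_eq_square)
  with True show ?thesis using zero_le_power2[of y] unfolding burkholder_def by (simp; linarith)
qed (simp add: burkholder_def)

text \<open>With \<open>1 \<le> \<bar>y\<bar>\<close> the diamond is met only at
  \<open>x = 0\<close>, \<open>\<bar>y\<bar> = 1\<close>, where both branches equal 1.\<close>

lemma burkholder_outside: "1 \<le> \<bar>y\<bar> \<Longrightarrow> burkholder x y = 1 - 2 * \<bar>x\<bar>"
proof (cases "x = 0")
  case True
  moreover assume "1 \<le> \<bar>y\<bar>"
  ultimately show ?thesis
    by (cases "\<bar>y\<bar> = 1") (auto simp: burkholder_def simp flip: power2_abs[of y])
qed (auto simp: burkholder_def)

lemma burkholder_zero_right: "burkholder x 0 \<le> 0"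
  by (auto simp: burkholder_def)

text \<open>Because \<open>s * s = 1\<close>, the squares of \<open>t\<close> cancel and
  \<open>y\<^sup>2 - x\<^sup>2\<close> is affine along the line. The right-hand side is this affine
  function, so inside the diamond equality holds; outside, it must be shown to dominate
  \<open>1 - 2 * \<bar>x + t\<bar>\<close>.\<close>

lemma burkholder_tangent:
  assumes "\<bar>x\<bar> + \<bar>y\<bar> \<le> 1" "\<bar>s\<bar> = 1"
  shows "burkholder (x + t) (y + s * t) \<le> y\<^sup>2 - x\<^sup>2 + 2 * t * (s * y - x)"
proof -
  have ss: "s * s = 1" using assms(2) by (metis abs_mult_self_eq mult_1)
  have eq: "(y + s * t)\<^sup>2 - (x + t)\<^sup>2 = y\<^sup>2 - x\<^sup>2 + 2 * t * (s * y - x)"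
    using ss by algebra
  show ?thesis
  proof (cases "\<bar>x + t\<bar> + \<bar>y + s * t\<bar> \<le> 1")
    case True
    then show ?thesis by (simp add: burkholder_def eq)
  next
    case False
    \<comment> \<open>The quantity \<open>x - s * y\<close> is constant along the line and at most 1
      in modulus in the diamond, so \<open>\<bar>x + t\<bar>\<close> exceeds
      \<open>\<bar>y + s * t\<bar>\<close> by at most 1.\<close>
    have "\<bar>(x + t) - s * (y + s * t)\<bar> \<le> 1"
    proof -
      have "(x + t) - s * (y + s * t) = x - s * y" using ss by algebra
      moreover have "\<bar>s * y\<bar> = \<bar>y\<bar>" using assms(2) by (simp add: abs_mult)
      ultimately show ?thesis using assms(1) by linarith
    qed
    moreover have "\<bar>s * (y + s * t)\<bar> = \<bar>y + s * t\<bar>" using assms(2) by (simp add: abs_mult)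
    ultimately have "\<bar>1 - \<bar>x + t\<bar>\<bar> \<le> \<bar>y + s * t\<bar>" using False by linarith
    then have "(1 - \<bar>x + t\<bar>)\<^sup>2 \<le> (y + s * t)\<^sup>2" by (simp flip: abs_le_square_iff)
    then have "1 - 2 * \<bar>x + t\<bar> \<le> (y + s * t)\<^sup>2 - (x + t)\<^sup>2" by (simp add: power2_diff)
    with False show ?thesis by (simp add: burkholder_def eq)
  qed
qed

text \<open>For a centre in the diamond, the tangent bounds at \<open>t\<close> and
  \<open>- t\<close> are added and their linear terms cancel. For a centre outside, the function
  equals there its global majorant \<open>1 - 2 * \<bar>x\<bar>\<close>, which is concave.\<close>

lemma burkholder_zigzag_concave:
  assumes "\<bar>s\<bar> = 1"
  shows "burkholder (x + t) (y + s * t) + burkholder (x - t) (y - s * t) \<le> 2 * burkholder x y"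
proof (cases "\<bar>x\<bar> + \<bar>y\<bar> \<le> 1")
  case True
  then show ?thesis
    using burkholder_tangent[OF True assms, of t] burkholder_tangent[OF True assms, of "-t"]
    by (simp add: burkholder_def)
next
  case False
  have "burkholder (x + t) (y + s * t) + burkholder (x - t) (y - s * t)
      \<le> (1 - 2 * \<bar>x + t\<bar>) + (1 - 2 * \<bar>x - t\<bar>)"
    by (intro add_mono burkholder_le)
  also have "\<dots> \<le> 2 * (1 - 2 * \<bar>x\<bar>)"
    using abs_triangle_ineq[of "x + t" "x - t"] by (simp add: abs_mult)
  finally show ?thesis using False by (simp add: burkholder_def)
qed

section \<open>The weak-type inequality for the maximal partial sum\<close>

text \<open>
  The starting value \<open>y\<close> is arbitrary so that the induction can pass from an interval to its halves.
\<close>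
lemma weak_type_dyadic:
  assumes int: "set_integrable lebesgue unit_interval \<phi>" and lam: "lam > 0"
    and eps: "\<And>I. I \<in> dyadic_intervals \<Longrightarrow> I \<subseteq> unit_interval \<Longrightarrow> \<bar>\<epsilon> I\<bar> = 1"
    and "k < 2 ^ m"
  shows "measure lebesgue
      {x \<in> dyadic m k. \<exists>j\<le>N. lam \<le> \<bar>y + (\<Sum>i<j. haar_layer \<epsilon> \<phi> (m + i) x)\<bar>}
    \<le> 2 / lam * (LINT x:dyadic m k|lebesgue. \<bar>\<phi> x\<bar>)
      + (1/2) ^ m * burkholder (dyadic_avg \<phi> m k / lam) (y / lam)"
  using \<open>k < 2 ^ m\<close>
proof (induction N arbitrary: m k y)
  \<comment> \<open>The modulus of a mean is at most the mean of the modulus; this lets the integral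
    of \<open>\<bar>\<phi>\<bar>\<close> compensate negative values of
    \<open>burkholder\<close>.\<close>
  have avg: "(1/2) ^ m * \<bar>dyadic_avg \<phi> m k / lam\<bar> \<le> (LINT x:dyadic m k|lebesgue. \<bar>\<phi> x\<bar>) / lam"
    for m k
  proof -
    have "\<bar>LINT x:dyadic m k|lebesgue. \<phi> x\<bar> \<le> (LINT x:dyadic m k|lebesgue. \<bar>\<phi> x\<bar>)"
      unfolding set_lebesgue_integral_def
      by (rule order_trans[OF integral_abs_bound]) (simp add: abs_mult)
    then show ?thesis
      using lam by (simp add: dyadic_avg_def abs_mult power_one_over divide_right_mono)
  qed
  \<comment> \<open>If the starting value already reaches \<open>lam\<close>, the measure of the
    whole interval is an affordable bound. The predicate \<open>P\<close> is arbitrary so that the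
    base case and the induction step can share this.\<close>
  have large: "measure lebesgue {x \<in> dyadic m k. P x}
    \<le> 2 / lam * (LINT x:dyadic m k|lebesgue. \<bar>\<phi> x\<bar>)
      + (1/2) ^ m * burkholder (dyadic_avg \<phi> m k / lam) (y / lam)"
    if y: "lam \<le> \<bar>y\<bar>" and [measurable]: "Measurable.pred lebesgue P" for m k y P
  proof -
    have "burkholder (dyadic_avg \<phi> m k / lam) (y / lam) = 1 - 2 * \<bar>dyadic_avg \<phi> m k / lam\<bar>"
      using y lam by (intro burkholder_outside) simp
    then have "(1/2) ^ m * burkholder (dyadic_avg \<phi> m k / lam) (y / lam)
        = (1/2) ^ m - 2 * ((1/2) ^ m * \<bar>dyadic_avg \<phi> m k / lam\<bar>)"
      by (simp only: right_diff_distrib) simp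
    moreover have "measure lebesgue {x \<in> dyadic m k. P x} \<le> measure lebesgue (dyadic m k)"
      by (intro measure_mono_fmeasurable dyadic_lmeasurable) auto
    moreover have "2 / lam * (LINT x:dyadic m k|lebesgue. \<bar>\<phi> x\<bar>)
        = 2 * ((LINT x:dyadic m k|lebesgue. \<bar>\<phi> x\<bar>) / lam)"
      by simp
    ultimately show ?thesis using avg[of m k] unfolding measure_dyadic by linarith
  qed
  {
    case (0 m k y)
    show ?case
    proof (cases "lam \<le> \<bar>y\<bar>")
      case True
      then show ?thesis by (intro large) auto
    next
      case False
      \<comment> \<open>Only \<open>j = 0\<close> is available and
        \<open>\<bar>y\<bar> < lam\<close>, so the set is empty and it remains to see that the bound
        is nonnegative.\<close>
      have "(1/2) ^ m * (- 2 * \<bar>dyadic_avg \<phi> m k / lam\<bar>)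
        \<le> (1/2) ^ m * burkholder (dyadic_avg \<phi> m k / lam) (y / lam)"
        by (intro mult_left_mono burkholder_ge) simp
      with False show ?thesis using avg[of m k] by simp
    qed
  next
    case (Suc N m k y)
    let ?S = "\<lambda>m j x. (\<Sum>i<j. haar_layer \<epsilon> \<phi> (m + i) x)"
    show ?case
    proof (cases "lam \<le> \<bar>y\<bar>")
      case True
      then show ?thesis by (intro large) auto
    next
      case False
      let ?e = "\<epsilon> (dyadic m k)"
      define d where "d = (dyadic_avg \<phi> (Suc m) (2*k+1) - dyadic_avg \<phi> (Suc m) (2*k)) / 2"
      define a where "a = dyadic_avg \<phi> m k"
      have a: "dyadic_avg \<phi> (Suc m) (2*k+1) = a + d" "dyadic_avg \<phi> (Suc m) (2*k) = a - d"
        using dyadic_avg_split[OF int Suc.prems] by (simp_all add: a_def d_def field_simps)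
      \<comment> \<open>From the interval to its right and left half the average moves by
        \<open>d\<close> and \<open>- d\<close>, the transform by \<open>?e * d\<close> and
        \<open>- ?e * d\<close>: both moves are along one line of slope \<open>?e\<close>.\<close>
      let ?R = "{x \<in> dyadic (Suc m) (2*k+1). \<exists>j\<le>N. lam \<le> \<bar>(y + ?e * d) + ?S (Suc m) j x\<bar>}"
      let ?L = "{x \<in> dyadic (Suc m) (2*k). \<exists>j\<le>N. lam \<le> \<bar>(y - ?e * d) + ?S (Suc m) j x\<bar>}"
      \<comment> \<open>As \<open>\<bar>y\<bar> < lam\<close>, the empty sum does not qualify; the
        first layer is split off and absorbed into the starting value.\<close>
      have ex: "(\<exists>j\<le>Suc N. lam \<le> \<bar>y + ?S m j x\<bar>)
          \<longleftrightarrow> (\<exists>j\<le>N. lam \<le> \<bar>(y + haar_layer \<epsilon> \<phi> m x) + ?S (Suc m) j x\<bar>)" for x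
      proof -
        have "(\<exists>j\<le>Suc N. P j) \<longleftrightarrow> P 0 \<or> (\<exists>j\<le>N. P (Suc j))" for P
          by (metis Suc_le_mono le0 not0_implies_Suc)
        from this[of "\<lambda>j. lam \<le> \<bar>y + ?S m j x\<bar>"]
        have "(\<exists>j\<le>Suc N. lam \<le> \<bar>y + ?S m j x\<bar>) \<longleftrightarrow> (\<exists>j\<le>N. lam \<le> \<bar>y + ?S m (Suc j) x\<bar>)"
          using False by simp
        then show ?thesis by (simp add: sum.lessThan_Suc_shift add.assoc del: sum.lessThan_Suc)
      qed
      have "{x \<in> dyadic m k. \<exists>j\<le>Suc N. lam \<le> \<bar>y + ?S m j x\<bar>} =
          {x \<in> dyadic (Suc m) (2*k+1). \<exists>j\<le>Suc N. lam \<le> \<bar>y + ?S m j x\<bar>}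
          \<union> {x \<in> dyadic (Suc m) (2*k). \<exists>j\<le>Suc N. lam \<le> \<bar>y + ?S m j x\<bar>}"
        using dyadic_split(1)[of m k] by blast
      also have "{x \<in> dyadic (Suc m) (2*k+1). \<exists>j\<le>Suc N. lam \<le> \<bar>y + ?S m j x\<bar>} = ?R"
        unfolding ex using haar_layer_right[OF int Suc.prems, of _ \<epsilon>]
        by (intro Collect_cong conj_cong refl) (simp only: d_def)
      also have "{x \<in> dyadic (Suc m) (2*k). \<exists>j\<le>Suc N. lam \<le> \<bar>y + ?S m j x\<bar>} = ?L"
        unfolding ex using haar_layer_left[OF int Suc.prems, of _ \<epsilon>]
        by (intro Collect_cong conj_cong refl)
          (simp only: d_def mult_minus_left add_uminus_conv_diff)
      finally have "{x \<in> dyadic m k. \<exists>j\<le>Suc N. lam \<le> \<bar>y + ?S m j x\<bar>} = ?R \<union> ?L" .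
      moreover have "measure lebesgue (?R \<union> ?L) \<le> measure lebesgue ?R + measure lebesgue ?L"
        by (intro measure_Un_le) auto
      moreover have "measure lebesgue ?R \<le> 2 / lam * (LINT x:dyadic (Suc m) (2*k+1)|lebesgue. \<bar>\<phi> x\<bar>)
          + (1/2) ^ Suc m * burkholder ((a + d) / lam) ((y + ?e * d) / lam)"
        unfolding a(1)[symmetric] using Suc.prems by (intro Suc.IH) simp
      moreover have "measure lebesgue ?L \<le> 2 / lam * (LINT x:dyadic (Suc m) (2*k)|lebesgue. \<bar>\<phi> x\<bar>)
          + (1/2) ^ Suc m * burkholder ((a - d) / lam) ((y - ?e * d) / lam)"
        unfolding a(2)[symmetric] using Suc.prems by (intro Suc.IH) simp
      moreover have "2 / lam * (LINT x:dyadic m k|lebesgue. \<bar>\<phi> x\<bar>) =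
          2 / lam * (LINT x:dyadic (Suc m) (2*k)|lebesgue. \<bar>\<phi> x\<bar>)
          + 2 / lam * (LINT x:dyadic (Suc m) (2*k+1)|lebesgue. \<bar>\<phi> x\<bar>)"
        using set_integral_dyadic_split[OF set_integrable_abs[OF int] Suc.prems]
        by (simp only: distrib_left)
      \<comment> \<open>The factor 2 from concavity restores the weight \<open>(1/2) ^ m\<close> of
        the parent interval.\<close>
      moreover have "(1/2) ^ Suc m * (burkholder ((a + d) / lam) ((y + ?e * d) / lam)
          + burkholder ((a - d) / lam) ((y - ?e * d) / lam))
          \<le> (1/2) ^ Suc m * (2 * burkholder (a / lam) (y / lam))"
        using burkholder_zigzag_concave[of ?e "a / lam" "d / lam" "y / lam"] Suc.prems
        by (intro mult_left_mono)
          (auto simp: add_divide_distrib diff_divide_distrib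
            intro!: eps dyadic_in_dyadic_intervals dyadic_subset_unit)
      ultimately show ?thesis
        unfolding a_def[symmetric] power_Suc distrib_left by simp
    qed
  }
qed

lemma weak_type_maximal:
  assumes int: "set_integrable lebesgue unit_interval \<phi>" and lam: "lam > 0"
    and eps: "\<And>I. I \<in> dyadic_intervals \<Longrightarrow> I \<subseteq> unit_interval \<Longrightarrow> \<bar>\<epsilon> I\<bar> = 1"
  shows "measure lebesgue {x \<in> dyadic 0 0. \<exists>n. lam \<le> \<bar>\<Sum>i<n. haar_layer \<epsilon> \<phi> i x\<bar>}
    \<le> 2 / lam * L1_norm \<phi>"
proof -
  define A where "A N = {x \<in> dyadic 0 0. \<exists>j\<le>N. lam \<le> \<bar>\<Sum>i<j. haar_layer \<epsilon> \<phi> i x\<bar>}" for N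
  have A_sets: "A N \<in> sets lebesgue" for N
    unfolding A_def by measurable
  have "measure lebesgue (A N) \<le> 2 / lam * L1_norm \<phi>" for N
  proof -
    have "measure lebesgue (A N) \<le> 2 / lam * (LINT x:dyadic 0 0|lebesgue. \<bar>\<phi> x\<bar>)
        + burkholder (dyadic_avg \<phi> 0 0 / lam) 0"
      using weak_type_dyadic[OF int lam eps, where m = 0 and k = 0 and N = N and y = 0] by (simp add: A_def)
    also have "\<dots> \<le> 2 / lam * (LINT x:dyadic 0 0|lebesgue. \<bar>\<phi> x\<bar>)"
      using burkholder_zero_right by simp
    \<comment> \<open>\<open>dyadic 0 0\<close> omits the point 1 of \<open>unit_interval\<close>;
      monotonicity of the integral is enough.\<close>
    also have "(LINT x:dyadic 0 0|lebesgue. \<bar>\<phi> x\<bar>) \<le> L1_norm \<phi>"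
    proof -
      have "set_integrable lebesgue (dyadic 0 0) (\<lambda>x. \<bar>\<phi> x\<bar>)"
        by (intro set_integrable_dyadic set_integrable_abs int) simp
      then show ?thesis
        using set_integrable_abs[OF int] dyadic_subset_unit[of 0 0]
        unfolding L1_norm_def set_lebesgue_integral_def set_integrable_def
        by (intro integral_mono) (auto simp: indicator_def)
    qed
    finally show ?thesis using lam by (simp add: divide_right_mono)
  qed
  moreover have "(\<lambda>N. measure lebesgue (A N)) \<longlonglongrightarrow> measure lebesgue (\<Union>N. A N)"
  proof (rule Lim_measure_incseq)
    show "incseq A" by (auto simp: incseq_def A_def intro: order_trans)
    have "(\<Union>N. A N) \<in> lmeasurable"
      by (rule fmeasurableI2[OF dyadic_lmeasurable[of 0 0]]) (use A_sets in \<open>auto simp: A_def\<close>)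
    then show "emeasure lebesgue (\<Union>N. A N) \<noteq> \<infinity>"
      by (auto simp: fmeasurable_def)
  qed (use A_sets in auto)
  ultimately have "measure lebesgue (\<Union>N. A N) \<le> 2 / lam * L1_norm \<phi>"
    by (intro LIMSEQ_le_const2) auto
  moreover have "(\<Union>N. A N) = {x \<in> dyadic 0 0. \<exists>n. lam \<le> \<bar>\<Sum>i<n. haar_layer \<epsilon> \<phi> i x\<bar>}"
    by (auto simp: A_def)
  ultimately show ?thesis by simp
qed

section \<open>Approximation in the L1 norm by continuous functions and by dyadic step
  functions\<close>

lemma unit_interval_lmeasurable: "unit_interval \<in> lmeasurable"
  by (simp add: unit_interval_def)

lemma unit_interval_sets [measurable]: "unit_interval \<in> sets borel" "unit_interval \<in> sets lebesgue"
  by (simp_all add: unit_interval_def)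

lemma measure_unit_interval: "measure lebesgue unit_interval = 1"
  by (simp add: unit_interval_def)

lemma integrable_unit_indicator:
  "integrable lebesgue (\<lambda>x. indicator unit_interval x * c :: real)"
  using unit_interval_lmeasurable by (intro integrable_mult_left) (simp add: fmeasurable_def)

lemma set_integrable_unit_bounded:
  fixes f :: "real \<Rightarrow> real"
  assumes [measurable]: "f \<in> borel_measurable lebesgue"
    and "\<And>x. x \<in> unit_interval \<Longrightarrow> \<bar>f x\<bar> \<le> c"
  shows "set_integrable lebesgue unit_interval f"
  unfolding set_integrable_def
  by (rule Bochner_Integration.integrable_bound[OF integrable_unit_indicator[of c]])
    (use assms(2) in \<open>force simp: indicator_def\<close>)+

lemma L1_norm_diff_triangle:
  assumes "set_integrable lebesgue unit_interval f" "set_integrable lebesgue unit_interval g"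
    "set_integrable lebesgue unit_interval h"
  shows "L1_norm (\<lambda>x. f x - h x) \<le> L1_norm (\<lambda>x. f x - g x) + L1_norm (\<lambda>x. g x - h x)"
proof -
  have "L1_norm (\<lambda>x. f x - h x) \<le> (LINT x:unit_interval|lebesgue. \<bar>f x - g x\<bar> + \<bar>g x - h x\<bar>)"
    unfolding L1_norm_def using assms
    by (intro set_integral_mono set_integrable_abs set_integral_add set_integral_diff) auto
  also have "\<dots> = L1_norm (\<lambda>x. f x - g x) + L1_norm (\<lambda>x. g x - h x)"
    unfolding L1_norm_def using assms
    by (intro set_integral_add set_integrable_abs set_integral_diff)
  finally show ?thesis .
qed

lemma L1_norm_dominated_limit:
  assumes "f \<in> borel_measurable lebesgue" "\<And>n. s n \<in> borel_measurable lebesgue"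
    and "set_integrable lebesgue unit_interval w"
    and "AE x in lebesgue. x \<in> unit_interval \<longrightarrow> (\<lambda>n. s n x) \<longlonglongrightarrow> f x"
    and "\<And>n x. x \<in> unit_interval \<Longrightarrow> \<bar>f x - s n x\<bar> \<le> w x"
  shows "(\<lambda>n. L1_norm (\<lambda>x. f x - s n x)) \<longlonglongrightarrow> 0"
proof -
  note [measurable] = assms(1,2)
  have "(\<lambda>n. LINT x|lebesgue. indicator unit_interval x *\<^sub>R \<bar>f x - s n x\<bar>)
      \<longlonglongrightarrow> (LINT x|(lebesgue :: real measure). (0::real))"
  proof (rule integral_dominated_convergence[where w = "\<lambda>x. indicator unit_interval x *\<^sub>R w x"])
    show "integrable lebesgue (\<lambda>x. indicator unit_interval x *\<^sub>R w x)"
      using assms(3) by (simp add: set_integrable_def)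
    show "AE x in lebesgue. (\<lambda>n. indicator unit_interval x *\<^sub>R \<bar>f x - s n x\<bar>) \<longlonglongrightarrow> 0"
      using assms(4)
    proof eventually_elim
      case (elim x)
      show ?case
      proof (cases "x \<in> unit_interval")
        case True
        with elim have "(\<lambda>n. \<bar>f x - s n x\<bar>) \<longlonglongrightarrow> \<bar>f x - f x\<bar>"
          by (intro tendsto_intros) auto
        with True show ?thesis by simp
      qed simp
    qed
    show "AE x in lebesgue. norm (indicator unit_interval x *\<^sub>R \<bar>f x - s n x\<bar>)
        \<le> indicator unit_interval x *\<^sub>R w x" for n
      using assms(5) by (auto simp: indicator_def)
  qed auto
  then show ?thesis by (simp add: L1_norm_def set_lebesgue_integral_def)
qed

text \<open>Clipping to \<open>[-k, k]\<close> supplies an integrable majorant for pointwise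
  approximants that come without any bound.\<close>

definition trunc :: "nat \<Rightarrow> real \<Rightarrow> real" where
  "trunc k v = max (- real k) (min (real k) v)"

lemma trunc_bound: "\<bar>trunc k v\<bar> \<le> real k"
  by (auto simp: trunc_def)

lemma trunc_diff_bound: "\<bar>v - trunc k v\<bar> \<le> \<bar>v\<bar>"
  by (auto simp: trunc_def max_def min_def)

lemma continuous_on_trunc [continuous_intros]:
  "continuous_on S f \<Longrightarrow> continuous_on S (\<lambda>x. trunc k (f x))"
  unfolding trunc_def by (intro continuous_intros)

lemma trunc_measurable [measurable]: "trunc k \<in> borel_measurable borel"
  unfolding trunc_def by measurable

text \<open>A Lebesgue measurable function is almost everywhere a limit of continuous ones. Clipping
  \<open>f\<close> costs less than \<open>e / 2\<close>, by dominated convergence with majorant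
  \<open>\<bar>f\<bar>\<close>; replacing the clipped \<open>f\<close> by a clipped continuous
  function costs less than another \<open>e / 2\<close>.\<close>

lemma L1_approx_continuous:
  assumes int: "set_integrable lebesgue unit_interval \<phi>" and "e > 0"
  obtains g where "continuous_on UNIV g" "set_integrable lebesgue unit_interval g"
    "L1_norm (\<lambda>x. \<phi> x - g x) < e"
proof -
  \<comment> \<open>Extension by zero, so that measurability is available on the whole line.\<close>
  define f where "f x = indicator unit_interval x *\<^sub>R \<phi> x" for x
  have f: "integrable lebesgue f" using int by (simp add: f_def[abs_def] set_integrable_def)
  then have fm [measurable]: "f \<in> borel_measurable lebesgue" by simp
  have fint: "set_integrable lebesgue unit_interval f"
    using integrable_mult_indicator[OF unit_interval_sets(2) f] by (simp add: set_integrable_def)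
  have "f measurable_on UNIV"
    using fm by (simp add: measurable_on_iff_borel_measurable lebesgue_on_UNIV_eq)
  then obtain Z g where Z: "negligible Z" and g: "\<And>n. continuous_on UNIV (g n)"
    and lim: "\<And>x. x \<notin> Z \<Longrightarrow> (\<lambda>n. g n x) \<longlonglongrightarrow> f x"
    unfolding measurable_on_def by auto
  have gm [measurable]: "g n \<in> borel_measurable lebesgue" for n
    using borel_measurable_continuous_onI[OF g] by (simp add: measurable_completion)
  have tm [measurable]: "(\<lambda>x. trunc k (h x)) \<in> borel_measurable lebesgue"
    if "h \<in> borel_measurable lebesgue" for h :: "real \<Rightarrow> real" and k
    using that by (rule measurable_compose) (rule trunc_measurable)
  have "(\<lambda>k. L1_norm (\<lambda>x. f x - trunc k (f x))) \<longlonglongrightarrow> 0"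
  proof (rule L1_norm_dominated_limit)
    show "set_integrable lebesgue unit_interval (\<lambda>x. \<bar>f x\<bar>)"
      by (intro set_integrable_abs fint)
    have "(\<lambda>k. trunc k (f x)) \<longlonglongrightarrow> f x" for x
    proof (rule tendsto_eventually, rule eventually_sequentiallyI)
      fix k assume "nat \<lceil>\<bar>f x\<bar>\<rceil> \<le> k"
      then have "\<bar>f x\<bar> \<le> real k" by linarith
      then show "trunc k (f x) = f x" by (auto simp: trunc_def)
    qed
    then show "AE x in lebesgue. x \<in> unit_interval \<longrightarrow> (\<lambda>k. trunc k (f x)) \<longlonglongrightarrow> f x" by simp
  qed (use trunc_diff_bound tm fm in auto)
  then obtain k where k: "L1_norm (\<lambda>x. f x - trunc k (f x)) < e / 2"
    using order_tendstoD(2)[of _ 0 _ "e / 2"] \<open>e > 0\<close> by (force simp: eventually_sequentially)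
  have "(\<lambda>n. L1_norm (\<lambda>x. trunc k (f x) - trunc k (g n x))) \<longlonglongrightarrow> 0"
  proof (rule L1_norm_dominated_limit)
    \<comment> \<open>Two values clipped at \<open>k\<close> differ by at most
      \<open>2 * real k\<close>, a majorant independent of \<open>n\<close>.\<close>
    show "set_integrable lebesgue unit_interval (\<lambda>x. 2 * real k)"
      by (rule set_integrable_unit_bounded[of _ "2 * real k"]) auto
    have "AE x in lebesgue. x \<notin> Z"
      using Z by (simp add: negligible_iff_null_sets AE_not_in)
    then show "AE x in lebesgue. x \<in> unit_interval \<longrightarrow> (\<lambda>n. trunc k (g n x)) \<longlonglongrightarrow> trunc k (f x)"
      unfolding trunc_def by eventually_elim (auto intro!: tendsto_intros lim)
    show "\<bar>trunc k (f x) - trunc k (g n x)\<bar> \<le> 2 * real k" for n x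
      using trunc_bound[of k "f x"] trunc_bound[of k "g n x"] by linarith
  qed (use tm fm gm in auto)
  then obtain n where n: "L1_norm (\<lambda>x. trunc k (f x) - trunc k (g n x)) < e / 2"
    using order_tendstoD(2)[of _ 0 _ "e / 2"] \<open>e > 0\<close> by (force simp: eventually_sequentially)
  have tint: "set_integrable lebesgue unit_interval (\<lambda>x. trunc k (h x))"
    if "h \<in> borel_measurable lebesgue" for h :: "real \<Rightarrow> real"
    using trunc_bound tm[OF that] by (intro set_integrable_unit_bounded[of _ "real k"])
  show ?thesis
  proof (rule that[of "\<lambda>x. trunc k (g n x)"])
    show "continuous_on UNIV (\<lambda>x. trunc k (g n x))" by (intro continuous_intros g)
    show "set_integrable lebesgue unit_interval (\<lambda>x. trunc k (g n x))" by (intro tint gm)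
    have "L1_norm (\<lambda>x. \<phi> x - trunc k (g n x)) = L1_norm (\<lambda>x. f x - trunc k (g n x))"
      unfolding L1_norm_def by (intro set_lebesgue_integral_cong) (auto simp: f_def)
    also have "\<dots> \<le> L1_norm (\<lambda>x. f x - trunc k (f x)) + L1_norm (\<lambda>x. trunc k (f x) - trunc k (g n x))"
      by (intro L1_norm_diff_triangle fint tint fm gm)
    finally show "L1_norm (\<lambda>x. \<phi> x - trunc k (g n x)) < e" using k n by simp
  qed
qed

text \<open>A continuous approximant is uniformly continuous on the compact unit interval, so
  sampling it on a fine enough dyadic grid changes it uniformly by at most
  \<open>e / 2\<close>.\<close>

lemma L1_approx_step:
  assumes int: "set_integrable lebesgue unit_interval \<phi>" and "e > 0"
  obtains N h where "set_integrable lebesgue unit_interval (\<lambda>x. h \<lfloor>x * 2 ^ N\<rfloor>)"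
    "L1_norm (\<lambda>x. \<phi> x - h \<lfloor>x * 2 ^ N\<rfloor>) < e"
proof -
  have e2: "e / 2 > 0" using \<open>e > 0\<close> by simp
  obtain g where g: "continuous_on UNIV g" and gint: "set_integrable lebesgue unit_interval g"
    and ge: "L1_norm (\<lambda>x. \<phi> x - g x) < e / 2"
    by (rule L1_approx_continuous[OF int e2])
  have "uniformly_continuous_on unit_interval g"
    unfolding unit_interval_def
    by (intro compact_uniformly_continuous continuous_on_subset[OF g]) auto
  from this e2 obtain d where "d > 0"
    and d: "\<And>x y. x \<in> unit_interval \<Longrightarrow> y \<in> unit_interval \<Longrightarrow> dist y x < d \<Longrightarrow> dist (g y) (g x) < e / 2"
    by (rule uniformly_continuous_onE) blast
  obtain N where N: "(1/2) ^ N < d"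
    using real_arch_pow_inv[OF \<open>d > 0\<close>, of "1/2"] by auto
  \<comment> \<open>The sample is taken at the left end point of each cell; the cells are shorter
    than the modulus of continuity \<open>d\<close>.\<close>
  define h where "h i = g (of_int i / 2 ^ N)" for i :: int
  have close: "\<bar>g x - h \<lfloor>x * 2 ^ N\<rfloor>\<bar> \<le> e / 2" if x: "x \<in> unit_interval" for x
  proof -
    define y where "y = of_int \<lfloor>x * 2 ^ N\<rfloor> / (2 ^ N :: real)"
    have "y \<le> x" by (simp add: y_def divide_le_eq)
    moreover have "x - (1/2) ^ N < y"
    proof -
      have "x * 2 ^ N - 1 < of_int \<lfloor>x * 2 ^ N\<rfloor>" by linarith
      then have "(x * 2 ^ N - 1) / 2 ^ N < y" unfolding y_def by (intro divide_strict_right_mono) auto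
      then show ?thesis by (simp add: diff_divide_distrib power_one_over)
    qed
    moreover have "0 \<le> y" using x by (simp add: y_def unit_interval_def)
    ultimately have "y \<in> unit_interval" "dist y x < d"
      using x N by (auto simp: unit_interval_def dist_real_def)
    from d[OF x this] show ?thesis by (simp add: h_def y_def dist_real_def abs_minus_commute)
  qed
  have gm: "g \<in> borel_measurable borel"
    by (rule borel_measurable_continuous_onI[OF g])
  then have hm: "(\<lambda>x::real. h \<lfloor>x * 2 ^ N\<rfloor>) \<in> borel_measurable borel"
    unfolding h_def by measurable
  have diff: "set_integrable lebesgue unit_interval (\<lambda>x. g x - h \<lfloor>x * 2 ^ N\<rfloor>)"
    using close gm hm by (intro set_integrable_unit_bounded[of _ "e / 2"] borel_measurable_diff)
      (auto simp: measurable_completion)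
  \<comment> \<open>The step function is \<open>g\<close> minus the difference \<open>diff\<close>,
    both integrable.\<close>
  have hint: "set_integrable lebesgue unit_interval (\<lambda>x. h \<lfloor>x * 2 ^ N\<rfloor>)"
    using set_integral_diff(1)[OF gint diff] by simp
  show ?thesis
  proof (rule that[OF hint])
    have "L1_norm (\<lambda>x. g x - h \<lfloor>x * 2 ^ N\<rfloor>) \<le> (LINT x:unit_interval|lebesgue. e / 2)"
      unfolding L1_norm_def using close \<open>e > 0\<close>
      by (intro set_integral_mono set_integrable_abs diff set_integrable_unit_bounded[of _ "e / 2"]) auto
    also have "\<dots> = e / 2"
      by (simp add: set_lebesgue_integral_def measure_unit_interval)
    finally show "L1_norm (\<lambda>x. \<phi> x - h \<lfloor>x * 2 ^ N\<rfloor>) < e"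
      using L1_norm_diff_triangle[OF int gint hint] ge by simp
  qed
qed

section \<open>Almost everywhere convergence of the Haar sums\<close>

lemma haar_layer_diff:
  assumes "set_integrable lebesgue unit_interval \<phi>" "set_integrable lebesgue unit_interval \<psi>"
  shows "haar_layer \<epsilon> (\<lambda>x. \<phi> x - \<psi> x) m x = haar_layer \<epsilon> \<phi> m x - haar_layer \<epsilon> \<psi> m x"
proof -
  have "haar_coeff (\<lambda>x. \<phi> x - \<psi> x) (dyadic m k) = haar_coeff \<phi> (dyadic m k) - haar_coeff \<psi> (dyadic m k)"
    if k: "k < 2 ^ m" for k
  proof -
    have "set_integrable lebesgue (dyadic (Suc m) l) \<phi>" "set_integrable lebesgue (dyadic (Suc m) l) \<psi>"
      if "l < 2 * 2 ^ m" for l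
      using assms that by (auto intro: set_integrable_dyadic)
    then have *: "(LINT x:dyadic (Suc m) l|lebesgue. \<phi> x - \<psi> x) =
        (LINT x:dyadic (Suc m) l|lebesgue. \<phi> x) - (LINT x:dyadic (Suc m) l|lebesgue. \<psi> x)"
      if "l < 2 * 2 ^ m" for l
      using that by (intro set_integral_diff) auto
    have l: "2 * k < 2 * 2 ^ m" "2 * k + 1 < 2 * 2 ^ m" using k by auto
    show ?thesis
      unfolding haar_coeff_dyadic[OF set_integral_diff(1)[OF assms] k]
        haar_coeff_dyadic[OF assms(1) k] haar_coeff_dyadic[OF assms(2) k]
        *[OF l(1)] *[OF l(2)] right_diff_distrib by simp
  qed
  then show ?thesis
    unfolding haar_layer_def sum_subtractf[symmetric]
    by (intro sum.cong refl) (simp add: left_diff_distrib right_diff_distrib)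
qed

text \<open>A function of \<open>\<lfloor>x * 2 ^ N\<rfloor>\<close> is constant on every dyadic
  interval of level at least \<open>N\<close>, so the integrals over its two halves cancel.\<close>

lemma haar_layer_step:
  assumes int: "set_integrable lebesgue unit_interval (\<lambda>x. h \<lfloor>x * 2 ^ N\<rfloor>)" and "N \<le> m"
  shows "haar_layer \<epsilon> (\<lambda>x. h \<lfloor>x * 2 ^ N\<rfloor>) m x = 0"
proof -
  have "haar_coeff (\<lambda>x. h \<lfloor>x * 2 ^ N\<rfloor>) (dyadic m k) = 0" if k: "k < 2 ^ m" for k
  proof -
    \<comment> \<open>\<open>int k div 2 ^ (m - N)\<close> is the index of the
      level-\<open>N\<close> interval containing \<open>dyadic m k\<close>.\<close>
    define c where "c = h (int k div 2 ^ (m - N))"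
    have c: "h \<lfloor>x * 2 ^ N\<rfloor> = c" if "x \<in> dyadic m k" for x
    proof -
      obtain j where "m = N + j" using \<open>N \<le> m\<close> le_Suc_ex by blast
      then have "x * 2 ^ N = x * 2 ^ m / of_int (2 ^ (m - N))"
        by (simp add: power_add)
      then have "\<lfloor>x * 2 ^ N\<rfloor> = \<lfloor>x * 2 ^ m\<rfloor> div 2 ^ (m - N)"
        by (simp only: floor_divide_real_eq_div zero_le_power zero_le_numeral)
      then show ?thesis using that by (simp add: c_def dyadic_mem_iff)
    qed
    have "(LINT x:dyadic (Suc m) l|lebesgue. h \<lfloor>x * 2 ^ N\<rfloor>) = (1/2) ^ Suc m * c"
      if "dyadic (Suc m) l \<subseteq> dyadic m k" for l
    proof -
      have "(LINT x:dyadic (Suc m) l|lebesgue. h \<lfloor>x * 2 ^ N\<rfloor>) = (LINT x:dyadic (Suc m) l|lebesgue. c)"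
        using that c by (intro set_lebesgue_integral_cong) auto
      then show ?thesis
        by (simp add: set_lebesgue_integral_def measure_dyadic del: power_Suc)
    qed
    from this[of "2 * k + 1"] this[of "2 * k"] dyadic_split(1)[of m k] show ?thesis
      unfolding haar_coeff_dyadic[OF int k] by (simp del: power_Suc)
  qed
  then show ?thesis by (simp add: haar_layer_def)
qed

text \<open>Subtracting a step function alters only finitely many layers and hence not the
  oscillation of the tails, while the remainder has small norm and so a small maximal function by
  the weak-type bound.\<close>

lemma haar_sums_converge_ae:
  assumes int: "set_integrable lebesgue unit_interval \<phi>"
    and eps: "\<And>I. I \<in> dyadic_intervals \<Longrightarrow> I \<subseteq> unit_interval \<Longrightarrow> \<bar>\<epsilon> I\<bar> = 1"
  shows "negligible {x \<in> dyadic 0 0. \<not> convergent (\<lambda>n. \<Sum>i<n. haar_layer \<epsilon> \<phi> i x)}"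
proof -
  let ?S = "\<lambda>\<phi> n x. \<Sum>i<n. haar_layer \<epsilon> \<phi> i x"
  \<comment> \<open>The points at which the partial sums keep oscillating by at least
    \<open>r\<close>.\<close>
  define B where
    "B r = {x \<in> dyadic 0 0. \<forall>N. \<exists>m\<ge>N. \<exists>n\<ge>N. r \<le> \<bar>?S \<phi> m x - ?S \<phi> n x\<bar>}" for r :: real
  have "negligible (B r)" if "r > 0" for r
    unfolding negligible_outer_le
  proof (intro allI impI)
    \<comment> \<open>The error \<open>e * r / 4\<close> is chosen because the weak-type bound at
      height \<open>r / 2\<close> multiplies the norm by \<open>4 / r\<close>. Height
      \<open>r / 2\<close> suffices: if two sums differ by \<open>r\<close>, one of them has modulus
      at least \<open>r / 2\<close>.\<close>
    fix e :: real assume "e > 0"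
    with \<open>r > 0\<close> have "e * r / 4 > 0" by simp
    then obtain N h where hint: "set_integrable lebesgue unit_interval (\<lambda>x. h \<lfloor>x * 2 ^ N\<rfloor>)"
      and h: "L1_norm (\<lambda>x. \<phi> x - h \<lfloor>x * 2 ^ N\<rfloor>) < e * r / 4"
      by (rule L1_approx_step[OF int])
    define \<psi> where "\<psi> x = h \<lfloor>x * 2 ^ N\<rfloor>" for x :: real
    define \<eta> where "\<eta> x = \<phi> x - \<psi> x" for x
    have \<eta>int: "set_integrable lebesgue unit_interval \<eta>"
      unfolding \<eta>_def \<psi>_def by (intro set_integral_diff int hint)
    have layer: "haar_layer \<epsilon> \<phi> m x = haar_layer \<epsilon> \<eta> m x" if "N \<le> m" for m x
      using haar_layer_diff[OF int hint, of \<epsilon> m x] haar_layer_step[OF hint that, of \<epsilon> x]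
      by (simp add: \<eta>_def[abs_def] \<psi>_def[abs_def])
    have diff: "?S \<phi> m x - ?S \<phi> n x = ?S \<eta> m x - ?S \<eta> n x" if "N \<le> m" "N \<le> n" for m n x
    proof -
      \<comment> \<open>From level \<open>N\<close> on, the two sequences of sums differ by an
        amount independent of \<open>m\<close>, which cancels in differences.\<close>
      have "?S \<phi> m x = ?S \<phi> N x + (?S \<eta> m x - ?S \<eta> N x)" if "N \<le> m" for m
        using that by (induction m rule: dec_induct) (simp_all add: layer)
      from this[OF that(1)] this[OF that(2)] show ?thesis by simp
    qed
    define T where "T = {x \<in> dyadic 0 0. \<exists>n. r / 2 \<le> \<bar>?S \<eta> n x\<bar>}"
    have "T \<in> sets lebesgue" unfolding T_def by measurable
    then have "T \<in> lmeasurable"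
      by (rule fmeasurableI2[OF dyadic_lmeasurable[of 0 0], rotated]) (auto simp: T_def)
    moreover have "measure lebesgue T \<le> e"
    proof -
      have "measure lebesgue T \<le> 2 / (r / 2) * L1_norm \<eta>"
        unfolding T_def using \<open>r > 0\<close> by (intro weak_type_maximal \<eta>int eps) auto
      also have "\<dots> \<le> 2 / (r / 2) * (e * r / 4)"
        using h \<open>r > 0\<close> by (intro mult_left_mono) (auto simp: \<eta>_def[abs_def] \<psi>_def[abs_def])
      also have "\<dots> = e" using \<open>r > 0\<close> by simp
      finally show ?thesis .
    qed
    moreover have "B r \<subseteq> T"
    proof
      fix x assume "x \<in> B r"
      then obtain m n where x: "x \<in> dyadic 0 0" and mn: "N \<le> m" "N \<le> n"
        and "r \<le> \<bar>?S \<phi> m x - ?S \<phi> n x\<bar>"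
        unfolding B_def by blast
      then have "r \<le> \<bar>?S \<eta> m x - ?S \<eta> n x\<bar>" by (simp only: diff[OF mn])
      then have "r / 2 \<le> \<bar>?S \<eta> m x\<bar> \<or> r / 2 \<le> \<bar>?S \<eta> n x\<bar>" by linarith
      with x show "x \<in> T" unfolding T_def by blast
    qed
    ultimately show "\<exists>T. B r \<subseteq> T \<and> T \<in> lmeasurable \<and> measure lebesgue T \<le> e" by blast
  qed
  \<comment> \<open>Countably many thresholds tending to 0 capture every failure of the Cauchy
    property.\<close>
  then have "negligible (\<Union>k. B (1 / Suc k))"
    by (intro negligible_countable_Union) auto
  moreover have "{x \<in> dyadic 0 0. \<not> convergent (\<lambda>n. ?S \<phi> n x)} \<subseteq> (\<Union>k. B (1 / Suc k))"
  proof clarify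
    fix x assume x: "x \<in> dyadic 0 0" and nc: "\<not> convergent (\<lambda>n. ?S \<phi> n x)"
    show "x \<in> (\<Union>k. B (1 / Suc k))"
    proof (rule ccontr)
      assume *: "x \<notin> (\<Union>k. B (1 / Suc k))"
      have "Cauchy (\<lambda>n. ?S \<phi> n x)"
      proof (rule metric_CauchyI)
        fix e :: real assume "e > 0"
        then obtain k where k: "1 / real (Suc k) < e" by (rule nat_approx_posE)
        from * have "x \<notin> B (1 / Suc k)" by blast
        with x obtain N where "\<forall>m\<ge>N. \<forall>n\<ge>N. \<not> 1 / Suc k \<le> \<bar>?S \<phi> m x - ?S \<phi> n x\<bar>"
          unfolding B_def by blast
        then have N: "\<bar>?S \<phi> m x - ?S \<phi> n x\<bar> < 1 / Suc k" if "m \<ge> N" "n \<ge> N" for m n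
          using that by (simp only: not_le)
        show "\<exists>M. \<forall>m\<ge>M. \<forall>n\<ge>M. dist (?S \<phi> m x) (?S \<phi> n x) < e"
          unfolding dist_real_def by (intro exI[of _ N] allI impI less_trans[OF N k])
      qed
      with nc show False by (simp add: Cauchy_convergent_iff)
    qed
  qed
  ultimately show ?thesis by (rule negligible_subset)
qed

section \<open>Passage from the maximal partial sum to the limit\<close>

theorem corollary2p4:
  fixes \<phi> :: "real \<Rightarrow> real" and \<epsilon> :: "real set \<Rightarrow> real" and lam :: real
  assumes "set_integrable lebesgue unit_interval \<phi>"
    and "lam > 0"
    and "\<And>I. I \<in> dyadic_intervals \<Longrightarrow> I \<subseteq> unit_interval \<Longrightarrow> \<bar>\<epsilon> I\<bar> = 1"
  shows "measure lebesgue {x \<in> unit_interval. \<bar>haar_sum \<epsilon> \<phi> x\<bar> \<ge> lam} \<le> 4 * (L1_norm \<phi> / lam)"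
proof -
  let ?S = "\<lambda>n x. \<Sum>i<n. haar_layer \<epsilon> \<phi> i x"
  define T where "T = {x \<in> dyadic 0 0. \<exists>n. lam / 2 \<le> \<bar>?S n x\<bar>}"
  \<comment> \<open>The point 1 is added because \<open>dyadic 0 0\<close> is half-open.\<close>
  define Z where "Z = insert 1 {x \<in> dyadic 0 0. \<not> convergent (\<lambda>n. ?S n x)}"
  have "T \<in> sets lebesgue" unfolding T_def by measurable
  then have T: "T \<in> lmeasurable"
    by (rule fmeasurableI2[OF dyadic_lmeasurable[of 0 0], rotated]) (auto simp: T_def)
  have Z: "negligible Z"
    unfolding Z_def using haar_sums_converge_ae[OF assms(1,3)] by simp
  have "{x \<in> unit_interval. \<bar>haar_sum \<epsilon> \<phi> x\<bar> \<ge> lam} \<subseteq> T \<union> Z"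
  proof clarify
    fix x assume x: "x \<in> unit_interval" "lam \<le> \<bar>haar_sum \<epsilon> \<phi> x\<bar>" "x \<notin> Z"
    then have x0: "x \<in> dyadic 0 0"
      by (auto simp: Z_def unit_interval_def dyadic_def)
    with x have "convergent (\<lambda>n. ?S n x)" by (simp add: Z_def)
    then obtain L where L: "(\<lambda>n. ?S n x) \<longlonglongrightarrow> L" by (auto simp: convergent_def)
    \<comment> \<open>\<open>haar_partial_sum\<close> with index \<open>n\<close> has
      \<open>Suc n\<close> layers, so its sequence is a shift of \<open>?S\<close>.\<close>
    then have "(\<lambda>n. haar_partial_sum \<epsilon> \<phi> n x) \<longlonglongrightarrow> L"
      unfolding haar_partial_sum_eq by (rule LIMSEQ_Suc)
    then have "haar_sum \<epsilon> \<phi> x = L" unfolding haar_sum_def by (rule limI)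
    moreover have "\<exists>n. lam / 2 \<le> \<bar>?S n x\<bar>"
    proof (rule ccontr)
      assume "\<not> (\<exists>n. lam / 2 \<le> \<bar>?S n x\<bar>)"
      then have "\<bar>L\<bar> \<le> lam / 2"
        by (intro LIMSEQ_le_const2[OF tendsto_rabs[OF L]]) (auto simp: not_le less_imp_le)
      with \<open>haar_sum \<epsilon> \<phi> x = L\<close> x(2) assms(2) show False by simp
    qed
    ultimately show "x \<in> T" using x0 by (simp add: T_def)
  qed
  moreover have "{x \<in> unit_interval. \<bar>haar_sum \<epsilon> \<phi> x\<bar> \<ge> lam} \<in> sets lebesgue"
    using measurable_haar_sum[of \<epsilon> \<phi>] by (simp add: unit_interval_def)
  ultimately have "measure lebesgue {x \<in> unit_interval. \<bar>haar_sum \<epsilon> \<phi> x\<bar> \<ge> lam}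
      \<le> measure lebesgue (T \<union> Z)"
    by (intro measure_mono_fmeasurable fmeasurable.Un[OF T negligible_imp_measurable[OF Z]])
  also have "\<dots> \<le> measure lebesgue T + measure lebesgue Z"
    by (intro measure_Un_le fmeasurableD T negligible_imp_measurable[OF Z])
  also have "measure lebesgue Z = 0"
    using Z by (rule negligible_imp_measure0)
  \<comment> \<open>Constant 2 at height \<open>lam / 2\<close> is constant 4 at height
    \<open>lam\<close>.\<close>
  also have "measure lebesgue T + 0 \<le> 2 / (lam / 2) * L1_norm \<phi>"
    unfolding T_def add_0_right using assms by (intro weak_type_maximal) auto
  finally show ?thesis by simp
qed

end
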